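(* Let $A\in\mathbb{R}^{n\times n}$ and $b\in\mathbb{R}^n$, and let $\Phi:\mathbb{R}^n\to\mathbb{R}^n$, $\Phi(x)=Ax-|x|-b$. The mapping $\Phi$ is monotone on $\mathbb{R}^n$, i.e. $\langle\Phi(x)-\Phi(y),x-y\rangle\ge 0$ for all $x,y\in\mathbb{R}^n$, if and only if $\operatorname{sym}(A)\succeq I$.
   Context: $|x|$ is the componentwise absolute value of $x\in\mathbb{R}^n$; $\langle\cdot,\cdot\rangle$ is the Euclidean inner product; $\operatorname{sym}(A)=(A+A^\top)/2$; $I$ is the $n\times n$ identity; for symmetric matrices $M\succeq N$ means that $M-N$ is positive semidefinite. The matrix $A$ is not assumed symmetric. *)

theory Defs
  imports "HOL-Analysis.Analysis"
begin

text \<open>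
  Monotonicity in the sense of operator theory, with respect to the inner product; this is
  unrelated to the order-theoretic predicates \<open>mono\<close> and \<open>monotone\<close> of the library.
\<close>

definition monotone_mapping_on :: "'a::real_inner set \<Rightarrow> ('a \<Rightarrow> 'a) \<Rightarrow> bool" where
  "monotone_mapping_on S F \<longleftrightarrow> (\<forall>x\<in>S. \<forall>y\<in>S. (F x - F y) \<bullet> (x - y) \<ge> 0)"

definition sym_part :: "real ^ 'n ^ 'n \<Rightarrow> real ^ 'n ^ 'n" where
  "sym_part A = (1 / 2) *\<^sub>R (A + transpose A)"

definition pos_semidef :: "real ^ 'n ^ 'n \<Rightarrow> bool" where
  "pos_semidef M \<longleftrightarrow> transpose M = M \<and> (\<forall>x. x \<bullet> (M *v x) \<ge> 0)"

text \<open>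
  The library order \<open>\<le>\<close> on \<open>real ^ 'n ^ 'n\<close> is entrywise, so the Loewner order needs
  its own symbol.
\<close>

definition loewner_ge :: "real ^ 'n ^ 'n \<Rightarrow> real ^ 'n ^ 'n \<Rightarrow> bool" (infix "\<succeq>" 50) where
  "M \<succeq> N \<longleftrightarrow> pos_semidef (M - N)"

text \<open>On \<open>real ^ 'n\<close> the library's \<open>\<bar>x\<bar>\<close> is the componentwise absolute value (\<open>abs_vec_def\<close>).\<close>

definition ave_map :: "real ^ 'n ^ 'n \<Rightarrow> real ^ 'n \<Rightarrow> real ^ 'n \<Rightarrow> real ^ 'n" where
  "ave_map A b x = A *v x - \<bar>x\<bar> - b"

end

theory Submission
  imports Defs
begin

text \<open>
  Writing \<open>h = x - y\<close>, monotonicity says \<open>\<langle>A h, h\<rangle> \<ge> \<langle>\<bar>x\<bar> - \<bar>y\<bar>, h\<rangle>\<close>. The right-hand side never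
  exceeds \<open>\<langle>h, h\<rangle>\<close>, and every \<open>h\<close> attains this bound as a difference of two nonnegative
  vectors, \<open>h = (\<bar>h\<bar> + h) - \<bar>h\<bar>\<close>.
\<close>

text \<open>Moving \<open>A\<close> across the inner product shows that \<open>A\<close> and its
  transpose have the same quadratic form, hence so does their average.\<close>

lemma inner_sym_part: "x \<bullet> (sym_part A *v x) = x \<bullet> (A *v x)"
proof -
  have "x \<bullet> (transpose A *v x) = x \<bullet> (A *v x)"
    by (metis dot_lmul_matrix inner_commute transpose_matrix_vector)
  then show ?thesis
    by (simp add: sym_part_def scaleR_matrix_vector_assoc[symmetric]
        matrix_vector_mult_add_rdistrib inner_add_right)
qed

lemma transpose_sym_part: "transpose (sym_part A) = sym_part A"
  by (simp add: sym_part_def transpose_def vec_eq_iff)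

text \<open>Both matrices are symmetric, so the symmetry clause of \<open>pos_semidef\<close> holds
  automatically and only the quadratic form remains.\<close>

lemma sym_part_loewner_ge_mat_1_iff:
  "sym_part A \<succeq> mat 1 \<longleftrightarrow> (\<forall>x. x \<bullet> x \<le> x \<bullet> (A *v x))"
proof -
  have "transpose (sym_part A - mat 1) = transpose (sym_part A) - transpose (mat 1)"
    by (simp add: transpose_def vec_eq_iff)
  then show ?thesis
    by (simp add: loewner_ge_def pos_semidef_def transpose_sym_part
        matrix_vector_mult_diff_rdistrib inner_diff_right inner_sym_part)
qed

text \<open>Coordinatewise, this is the reverse triangle inequality multiplied by
  \<open>\<bar>a - c\<bar>\<close>; summing over coordinates gives the claim.\<close>

lemma inner_abs_diff_le:
  fixes x y :: "real ^ 'n"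
  shows "(\<bar>x\<bar> - \<bar>y\<bar>) \<bullet> (x - y) \<le> (x - y) \<bullet> (x - y)"
proof -
  have "(\<bar>a\<bar> - \<bar>c\<bar>) * (a - c) \<le> (a - c) * (a - c)" for a c :: real
  proof -
    have "(\<bar>a\<bar> - \<bar>c\<bar>) * (a - c) \<le> \<bar>\<bar>a\<bar> - \<bar>c\<bar>\<bar> * \<bar>a - c\<bar>"
      by (metis abs_ge_self abs_mult)
    also have "\<dots> \<le> \<bar>a - c\<bar> * \<bar>a - c\<bar>"
      by (intro mult_right_mono abs_triangle_ineq3) simp
    finally show ?thesis by simp
  qed
  then show ?thesis
    by (auto simp: inner_vec_def abs_vec_def intro!: sum_mono)
qed

lemma inner_ave_map_diff:
  "(ave_map A b x - ave_map A b y) \<bullet> (x - y) =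
    (x - y) \<bullet> (A *v (x - y)) - (\<bar>x\<bar> - \<bar>y\<bar>) \<bullet> (x - y)"
proof -
  have "ave_map A b x - ave_map A b y = A *v (x - y) - (\<bar>x\<bar> - \<bar>y\<bar>)"
    by (simp add: ave_map_def matrix_vector_mult_diff_distrib)
  then show ?thesis
    by (simp add: inner_diff_left inner_diff_right inner_commute)
qed

theorem proposition2p1:
  fixes A :: "real ^ 'n ^ 'n" and b :: "real ^ 'n"
  shows "monotone_mapping_on UNIV (ave_map A b) \<longleftrightarrow> sym_part A \<succeq> mat 1"
proof -
  have "monotone_mapping_on UNIV (ave_map A b) \<longleftrightarrow>
      (\<forall>x y. (\<bar>x\<bar> - \<bar>y\<bar>) \<bullet> (x - y) \<le> (x - y) \<bullet> (A *v (x - y)))"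
    by (simp add: monotone_mapping_on_def inner_ave_map_diff)
  also have "\<dots> \<longleftrightarrow> (\<forall>h. h \<bullet> h \<le> h \<bullet> (A *v h))"
  proof (intro iffI allI)
    fix h :: "real ^ 'n"
    assume *: "\<forall>x y. (\<bar>x\<bar> - \<bar>y\<bar>) \<bullet> (x - y) \<le> (x - y) \<bullet> (A *v (x - y))"
    \<comment> \<open>Since \<open>- h \<le> \<bar>h\<bar>\<close> in each coordinate, the outer
      absolute values change nothing, and the left side of \<open>*\<close> becomes
      \<open>h \<bullet> h\<close>.\<close>
    have "\<bar>\<bar>h\<bar> + h\<bar> - \<bar>\<bar>h\<bar>\<bar> = h"
      by (auto simp: vec_eq_iff abs_vec_def)
    then show "h \<bullet> h \<le> h \<bullet> (A *v h)"
      using *[rule_format, of "\<bar>h\<bar> + h" "\<bar>h\<bar>"] by simp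
  next
    fix x y :: "real ^ 'n"
    assume "\<forall>h. h \<bullet> h \<le> h \<bullet> (A *v h)"
    then show "(\<bar>x\<bar> - \<bar>y\<bar>) \<bullet> (x - y) \<le> (x - y) \<bullet> (A *v (x - y))"
      using inner_abs_diff_le order_trans by blast
  qed
  finally show ?thesis
    by (simp add: sym_part_loewner_ge_mat_1_iff)
qed

end
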